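(* Let $p\ge 1$ be an integer and let $m:(0,\infty)\to(0,\infty)$ be a differentiable function. If $$\int_0^1 w^{-p/2}m(w)^{-1}\,dw=\infty\qquad\text{and}\qquad\int_1^\infty w^{-p/2}m(w)^{-1}\,dw=\infty,$$ then the estimator $$\delta_m(X)=X+\nabla\log m(\|X\|^2)=\left\{1+2\frac{m'(\|X\|^2)}{m(\|X\|^2)}\right\}X$$ of the mean vector $\theta$ based on $X\sim N_p(\theta,I_p)$ is quasi-admissible.
   Context: $\|\cdot\|$ is the Euclidean norm on $\mathbb{R}^p$ and $\nabla=(\partial/\partial x_1,\dots,\partial/\partial x_p)'$. For a positive differentiable function $m$ on $(0,\infty)$, the estimator $\delta_m$ is $\delta_m(x)=x+\nabla\log m(\|x\|^2)=\{1+2m'(\|x\|^2)/m(\|x\|^2)\}x$ (for $x\neq 0$). Competitors of $\delta_m$ are the estimators $\delta_{m,k}(x)=\delta_m(x)+k(\|x\|^2)x$ with $k:(0,\infty)\to\mathbb{R}$ differentiable. The difference of the unbiased risk estimators (under loss $\|\delta-\theta\|^2$) of $\delta_{m,k}$ and $\delta_m$ is, with $w=\|x\|^2$, $$\Delta(m,mk)(w)=4w\frac{m'(w)}{m(w)}k(w)+2p\,k(w)+4w\,k'(w)+w\,k(w)^2 .$$ The estimator $\delta_m$ is called quasi-admissible if there exists no differentiable $k$ such that $\Delta(m,mk)(w)\le 0$ for all $w>0$ with strict inequality for some $w$. *)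

theory Defs
  imports "HOL-Analysis.Analysis"
begin

definition gradient :: "(real ^ 'n \<Rightarrow> real) \<Rightarrow> real ^ 'n \<Rightarrow> real ^ 'n" where
  "gradient f x = (\<chi> i. deriv (\<lambda>t. f (x + t *\<^sub>R axis i 1)) 0)"

text \<open>Functions on \<open>(0, \<infinity>)\<close> are total functions on the reals of which only the values at positive
  arguments matter; accordingly the value of an estimator at the origin is irrelevant.\<close>

definition pos_differentiable :: "(real \<Rightarrow> real) \<Rightarrow> bool" where
  "pos_differentiable m \<longleftrightarrow> (\<forall>w>0. m w > 0) \<and> m differentiable_on {0<..}"

definition delta :: "(real \<Rightarrow> real) \<Rightarrow> real ^ 'n \<Rightarrow> real ^ 'n" where
  "delta m x = x + gradient (\<lambda>y. ln (m ((norm y)\<^sup>2))) x"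

text \<open>By Stein's identity, the unbiased risk estimator of \<open>x + g x\<close> for \<open>N\<^sub>p(\<theta>, I\<^sub>p)\<close> under the loss
  \<open>\<parallel>\<delta> - \<theta>\<parallel>\<^sup>2\<close> is \<open>p + 2 div g + \<parallel>g\<parallel>\<^sup>2\<close>. The function below is the difference of those of
  \<open>\<lambda>x. delta m x + k (\<parallel>x\<parallel>\<^sup>2) x\<close> and \<open>delta m\<close> at \<open>w = \<parallel>x\<parallel>\<^sup>2\<close>; the second derivatives of \<open>m\<close>
  cancel in it, so that it makes sense when \<open>m\<close> is differentiable only once.\<close>

definition risk_diff :: "nat \<Rightarrow> (real \<Rightarrow> real) \<Rightarrow> (real \<Rightarrow> real) \<Rightarrow> real \<Rightarrow> real" where
  "risk_diff p m k w =
     4 * w * (deriv m w / m w) * k w + 2 * real p * k w + 4 * w * deriv k w + w * (k w)\<^sup>2"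

text \<open>Quasi-admissibility is a property of an estimator of the form \<open>delta m\<close>. The function \<open>m\<close>
  is determined by the estimator only up to a constant factor, on which \<open>risk_diff\<close> does not
  depend; see \<open>quasi_admissible_delta_iff\<close> below.\<close>

definition quasi_admissible :: "(real ^ 'n \<Rightarrow> real ^ 'n) \<Rightarrow> bool" where
  "quasi_admissible \<delta> \<longleftrightarrow>
     (\<exists>m. pos_differentiable m \<and> (\<forall>x. x \<noteq> 0 \<longrightarrow> \<delta> x = delta m x) \<and>
        \<not> (\<exists>k. k differentiable_on {0<..} \<and>
              (\<forall>w>0. risk_diff CARD('n) m k w \<le> 0) \<and>
              (\<exists>w>0. risk_diff CARD('n) m k w < 0)))"

lemma delta_eq:
  fixes x :: "real ^ 'n"
  assumes m: "pos_differentiable m" and x: "x \<noteq> 0"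
  shows "delta m x = (1 + 2 * (deriv m ((norm x)\<^sup>2) / m ((norm x)\<^sup>2))) *\<^sub>R x"
proof -
  let ?w = "(norm x)\<^sup>2"
  have w: "?w > 0" using x by simp
  have mw: "m ?w > 0" and "m differentiable at ?w"
    using m w unfolding pos_differentiable_def by (auto simp: differentiable_on_eq_differentiable_at)
  then have dm: "(m has_real_derivative deriv m ?w) (at ?w)"
    by (simp add: DERIV_deriv_iff_real_differentiable)
  have "((\<lambda>t. ln (m ((norm (x + t *\<^sub>R axis i 1))\<^sup>2))) has_real_derivative
          2 * (deriv m ?w / m ?w) * x $ i) (at 0)" for i
  proof -
    have e: "(norm (x + t *\<^sub>R axis i 1))\<^sup>2 = ?w + 2 * t * x $ i + t\<^sup>2" for t
      unfolding power2_norm_eq_inner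
      by (simp add: inner_add_left inner_add_right inner_axis inner_axis' power2_eq_square
          algebra_simps)
    have d: "((\<lambda>t. ?w + 2 * t * x $ i + t\<^sup>2) has_real_derivative 2 * x $ i) (at 0)"
      by (auto intro!: derivative_eq_intros)
    have "((\<lambda>t. m (?w + 2 * t * x $ i + t\<^sup>2)) has_real_derivative deriv m ?w * (2 * x $ i)) (at 0)"
      by (rule DERIV_chain2[OF _ d]) (use dm in simp)
    from DERIV_chain2[OF _ this, of ln "1 / m ?w"] DERIV_ln_divide[OF mw]
    have "((\<lambda>t. ln (m (?w + 2 * t * x $ i + t\<^sup>2))) has_real_derivative
            1 / m ?w * (deriv m ?w * (2 * x $ i))) (at 0)" by simp
    then show ?thesis unfolding e by (simp add: mult_ac)
  qed
  then have "gradient (\<lambda>y. ln (m ((norm y)\<^sup>2))) x = (\<chi> i. 2 * (deriv m ?w / m ?w) * x $ i)"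
    unfolding gradient_def vec_eq_iff by (auto intro: DERIV_imp_deriv)
  then show ?thesis
    unfolding delta_def by (simp add: vec_eq_iff algebra_simps)
qed

lemma quasi_admissible_delta_iff:
  assumes m: "pos_differentiable m"
  shows "quasi_admissible (delta m :: real ^ 'n \<Rightarrow> real ^ 'n) \<longleftrightarrow>
     \<not> (\<exists>k. k differentiable_on {0<..} \<and>
           (\<forall>w>0. risk_diff CARD('n) m k w \<le> 0) \<and>
           (\<exists>w>0. risk_diff CARD('n) m k w < 0))"
proof -
  have eq: "risk_diff p n k w = risk_diff p m k w"
    if n: "pos_differentiable n" and w: "w > 0"
      and agree: "\<forall>x. x \<noteq> 0 \<longrightarrow> delta m x = (delta n x :: real ^ 'n)" for n k w p
  proof -
    define x :: "real ^ 'n" where "x = sqrt w *\<^sub>R axis undefined 1"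
    have nx: "(norm x)\<^sup>2 = w" and x: "x \<noteq> 0"
      using w by (auto simp: x_def norm_axis_1 power_mult_distrib)
    from agree x delta_eq[OF m x] delta_eq[OF n x]
    have "deriv m w / m w = deriv n w / n w" unfolding nx by simp
    then show ?thesis by (simp add: risk_diff_def)
  qed
  show ?thesis
    unfolding quasi_admissible_def using m eq by (smt (verit))
qed

end

theory Submission
  imports Defs
begin

text \<open>Put \<open>h w = w\<^sup>-\<^sup>p\<^sup>/\<^sup>2 / m w\<close> and \<open>g = k / h\<close>. The risk difference equals \<open>w h (4 g' + g\<^sup>2 h)\<close>, so a
  competitor at least as good as \<open>delta m\<close> gives a solution of the Riccati inequality
  \<open>4 g' + g\<^sup>2 h \<le> 0\<close>. Then \<open>g\<close> is nonincreasing, and wherever it does not vanish \<open>(1 / g)' \<ge> h / 4\<close>.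
  If \<open>g\<close> is negative at some point, it stays negative to the right of it and \<open>1 / g < 0\<close> forces \<open>h\<close>
  to be integrable at \<open>\<infinity>\<close>; if \<open>g\<close> is positive at some point, it is positive to the left of it and
  \<open>1 / g > 0\<close> forces \<open>h\<close> to be integrable at \<open>0\<close>. Hence \<open>g = 0\<close> and the risk difference vanishes.\<close>

text \<open>On each compact interval the fundamental theorem turns the integral into an increment of
  \<open>H\<close>, which is at most \<open>C\<close>; continuity from below of the measure with
  density \<open>h\<close> carries this bound to the union.\<close>

lemma nn_integral_bounded_antiderivative:
  fixes h H :: "real \<Rightarrow> real"
  assumes meas: "h \<in> borel_measurable borel"
    and deriv: "\<And>x. x \<in> S \<Longrightarrow> (H has_real_derivative h x) (at x)"
    and nonneg: "\<And>x. x \<in> S \<Longrightarrow> 0 \<le> h x"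
    and bound: "\<And>x y. x \<in> S \<Longrightarrow> y \<in> S \<Longrightarrow> H y - H x \<le> C"
    and inc: "incseq (\<lambda>n. {a n..b n})" and S: "S = (\<Union>n. {a n..b n})"
  shows "(\<integral>\<^sup>+x\<in>S. ennreal (h x) \<partial>lborel) \<le> ennreal C"
proof -
  let ?D = "density lborel (\<lambda>x. ennreal (h x))"
  have em: "emeasure ?D A = (\<integral>\<^sup>+x\<in>A. ennreal (h x) \<partial>lborel)" if "A \<in> sets borel" for A
    using that meas by (simp add: emeasure_density)
  have le: "emeasure ?D {a n..b n} \<le> ennreal C" for n
  proof (cases "a n \<le> b n")
    case True
    have sub: "{a n..b n} \<subseteq> S" using S by blast
    have "(\<integral>\<^sup>+x. ennreal (h x) * indicator {a n..b n} x \<partial>lborel) = ennreal (H (b n) - H (a n))"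
      using sub True by (intro nn_integral_FTC_Icc meas)
        (auto intro!: nonneg deriv has_vector_derivative_at_within
          simp flip: has_real_derivative_iff_has_vector_derivative)
    moreover have "H (b n) - H (a n) \<le> C" using sub True by (intro bound) auto
    ultimately show ?thesis by (simp add: em ennreal_leI)
  qed simp
  have "emeasure ?D S = (SUP n. emeasure ?D {a n..b n})"
    unfolding S by (rule SUP_emeasure_incseq[symmetric]) (use inc in auto)
  also have "\<dots> \<le> ennreal C" by (intro SUP_least le)
  finally show ?thesis using S by (subst (asm) em) auto
qed

text \<open>Dividing the Riccati inequality by \<open>g\<^sup>2\<close> gives
  \<open>(4 / g)' = - 4 * g' / g\<^sup>2 \<ge> h\<close>, so \<open>4 / g - H\<close> is
  nondecreasing.\<close>

lemma riccati_inequality_solution_bound: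
  fixes g g' h H :: "real \<Rightarrow> real"
  assumes "a \<le> b"
    and g: "\<And>w. a \<le> w \<Longrightarrow> w \<le> b \<Longrightarrow> (g has_real_derivative g' w) (at w)"
    and H: "\<And>w. a \<le> w \<Longrightarrow> w \<le> b \<Longrightarrow> (H has_real_derivative h w) (at w)"
    and ric: "\<And>w. a \<le> w \<Longrightarrow> w \<le> b \<Longrightarrow> 4 * g' w + (g w)\<^sup>2 * h w \<le> 0"
    and nz: "\<And>w. a \<le> w \<Longrightarrow> w \<le> b \<Longrightarrow> g w \<noteq> 0"
  shows "H b - H a \<le> 4 / g b - 4 / g a"
proof -
  have "4 / g a - H a \<le> 4 / g b - H b"
  proof (rule DERIV_nonneg_imp_nondecreasing[OF \<open>a \<le> b\<close>])
    fix w assume w: "a \<le> w" "w \<le> b"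
    have "((\<lambda>w. 4 / g w - H w) has_real_derivative - (4 * g' w) / (g w)\<^sup>2 - h w) (at w)"
      using g[OF w] H[OF w] nz[OF w] by (auto intro!: derivative_eq_intros simp: power2_eq_square)
    moreover have "0 \<le> - (4 * g' w) / (g w)\<^sup>2 - h w"
      using ric[OF w] nz[OF w] by (simp add: field_simps)
    ultimately show "\<exists>y. ((\<lambda>w. 4 / g w - H w) has_real_derivative y) (at w) \<and> 0 \<le> y" by blast
  qed
  then show ?thesis by simp
qed

lemma riccati_inequality_solution_zero:
  fixes g g' h :: "real \<Rightarrow> real"
  assumes cont: "continuous_on {0<..} h" and pos: "\<And>w. 0 < w \<Longrightarrow> 0 \<le> h w"
    and int0: "(\<integral>\<^sup>+w\<in>{0<..1}. ennreal (h w) \<partial>lborel) = \<infinity>"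
    and int1: "(\<integral>\<^sup>+w\<in>{1..}. ennreal (h w) \<partial>lborel) = \<infinity>"
    and g: "\<And>w. 0 < w \<Longrightarrow> (g has_real_derivative g' w) (at w)"
    and ric: "\<And>w. 0 < w \<Longrightarrow> 4 * g' w + (g w)\<^sup>2 * h w \<le> 0"
    and "0 < w"
  shows "g w = 0"
proof (rule ccontr)
  assume "g w \<noteq> 0"
  have "isCont h x" if "0 < x" for x
    using cont that by (simp add: continuous_on_eq_continuous_at)
  \<comment> \<open>A single antiderivative on all of \<open>{0<..}\<close> serves both ends;
    \<open>h\<close> may be singular at 0.\<close>
  then obtain H where "\<forall>x::real. 0 < ereal x \<longrightarrow> ereal x < \<infinity> \<longrightarrow> (H has_vector_derivative h x) (at x)"
    using einterval_antiderivative[of 0 \<infinity> h] by (force simp flip: zero_ereal_def)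
  then have H: "(H has_real_derivative h x) (at x)" if "0 < x" for x
    using that by (simp add: has_real_derivative_iff_has_vector_derivative)
  have H_mono: "H x \<le> H y" if "0 < x" "x \<le> y" for x y
  proof (rule DERIV_nonneg_imp_nondecreasing[OF that(2)])
    fix z assume "x \<le> z"
    then have "0 < z" using that by simp
    then show "\<exists>y. (H has_real_derivative y) (at z) \<and> 0 \<le> y" using H pos by blast
  qed
  have g_anti: "g y \<le> g x" if "0 < x" "x \<le> y" for x y
  proof (rule DERIV_nonpos_imp_nonincreasing[OF that(2)])
    fix z assume "x \<le> z"
    then have z: "0 < z" using that by simp
    have "0 \<le> (g z)\<^sup>2 * h z" using pos[OF z] by simp
    then have "g' z \<le> 0" using ric[OF z] by linarith
    then show "\<exists>y. (g has_real_derivative y) (at z) \<and> y \<le> 0" using g[OF z] by blast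
  qed
  \<comment> \<open>Extension by zero makes \<open>h\<close> Borel on the whole line without
    changing its integral over subsets of \<open>{0<..}\<close>.\<close>
  let ?h = "\<lambda>x. if x \<in> {0<..} then h x else 0"
  have meas: "?h \<in> borel_measurable borel"
    by (rule borel_measurable_continuous_on_if) (use cont in auto)
  \<comment> \<open>Common end of both sign cases: it remains only to bound the increments of
    \<open>H\<close> near the relevant end.\<close>
  have finite: False
    if S: "S = (\<Union>n. {a n..b n})" and inc: "incseq (\<lambda>n. {a n..b n})" and S0: "S \<subseteq> {0<..}"
      and C: "\<And>x y. x \<in> S \<Longrightarrow> y \<in> S \<Longrightarrow> H y - H x \<le> C"
      and inf: "(\<integral>\<^sup>+w\<in>S. ennreal (h w) \<partial>lborel) = \<infinity>" for S C and a b :: "nat \<Rightarrow> real"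
  proof -
    have "(\<integral>\<^sup>+w\<in>S. ennreal (?h w) \<partial>lborel) \<le> ennreal C"
      using S0 H pos C by (intro nn_integral_bounded_antiderivative[OF meas _ _ _ inc S]) auto
    moreover have "(\<integral>\<^sup>+w\<in>S. ennreal (?h w) \<partial>lborel) = (\<integral>\<^sup>+w\<in>S. ennreal (h w) \<partial>lborel)"
      using S0 by (intro nn_integral_cong) (auto split: split_indicator)
    ultimately show False using inf by (simp add: top_unique)
  qed
  from \<open>g w \<noteq> 0\<close> consider "g w < 0" | "g w > 0" by linarith
  then show False
  proof cases
    case 1
    have bound: "H y \<le> H w - 4 / g w" if "0 < y" for y
    proof (cases "y \<le> w")
      case True
      have "4 / g w < 0" using 1 by (simp add: divide_less_0_iff)
      then show ?thesis using H_mono[OF that True] by linarith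
    next
      case False
      have neg: "g z < 0" if "w \<le> z" for z using g_anti[OF \<open>0 < w\<close> that] 1 by linarith
      have "H y - H w \<le> 4 / g y - 4 / g w"
        using False \<open>0 < w\<close> by (intro riccati_inequality_solution_bound[OF _ g H ric] less_imp_neq neg) auto
      moreover have "4 / g y < 0" using neg False by (simp add: divide_less_0_iff)
      ultimately show ?thesis by linarith
    qed
    have diff: "H y - H x \<le> H w - 4 / g w - H 1" if "x \<in> {1..}" "y \<in> {1..}" for x y
      using bound[of y] H_mono[of 1 x] that by simp
    \<comment> \<open>The interval for \<open>n = 0\<close> is empty and does no harm.\<close>
    have union: "{1..} = (\<Union>n. {1..real n})"
      using real_arch_simple by auto
    have inc: "incseq (\<lambda>n. {1..real n})" by (auto simp: incseq_def)
    show False by (rule finite[OF union inc _ diff int1]) auto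
  next
    case 2
    \<comment> \<open>Mirror image: to the left of \<open>w\<close>, the dropped term is
      \<open>- 4 / g x < 0\<close>.\<close>
    have bound: "H w - 4 / g w \<le> H x" if "0 < x" for x
    proof (cases "w \<le> x")
      case True
      have "4 / g w > 0" using 2 by simp
      then show ?thesis using H_mono[OF \<open>0 < w\<close> True] by linarith
    next
      case False
      have gpos: "g z > 0" if "0 < z" "z \<le> w" for z using g_anti[OF that] 2 by linarith
      have "H w - H x \<le> 4 / g w - 4 / g x"
        using False that
        by (intro riccati_inequality_solution_bound[OF _ g H ric] less_imp_neq[symmetric] gpos) auto
      moreover have "4 / g x > 0" using gpos that False by simp
      ultimately show ?thesis by linarith
    qed
    have diff: "H y - H x \<le> H 1 - (H w - 4 / g w)" if "x \<in> {0<..1}" "y \<in> {0<..1}" for x y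
      using bound[of x] H_mono[of y 1] that by simp
    \<comment> \<open>\<open>Suc n\<close> matters: since \<open>inverse 0 = 0\<close>, an index
      starting at 0 would let the point 0 into the union.\<close>
    have union: "{0<..1} = (\<Union>n. {inverse (real (Suc n))..1})"
    proof (intro equalityI subsetI)
      fix x :: real assume "x \<in> {0<..1}"
      then show "x \<in> (\<Union>n. {inverse (real (Suc n))..1})"
        using reals_Archimedean[of x] by (auto intro: less_imp_le)
    next
      fix x assume "x \<in> (\<Union>n. {inverse (real (Suc n))..1})"
      then obtain n where "inverse (real (Suc n)) \<le> x" "x \<le> 1" by auto
      moreover have "0 < inverse (real (Suc n))" by simp
      ultimately have "0 < x" by linarith
      with \<open>x \<le> 1\<close> show "x \<in> {0<..1}" by simp
    qed
    have inc: "incseq (\<lambda>n. {inverse (real (Suc n))..1})"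
      by (auto simp: incseq_def intro: order_trans[rotated] le_imp_inverse_le)
    show False by (rule finite[OF union inc _ diff int0]) auto
  qed
qed

text \<open>\<open>1 / h\<close> is the integrating factor \<open>w powr (p / 2) * m w\<close>, with
  logarithmic derivative \<open>p / (2 * w) + m' / m\<close>; hence
  \<open>4 * w * h * (k / h)'\<close> collects the three terms linear in \<open>k\<close> and
  \<open>k'\<close>. The factor \<open>w * h w\<close> is positive, so signs are preserved.\<close>

lemma risk_diff_eq:
  fixes m k h :: "real \<Rightarrow> real" and p :: nat
  assumes w: "w > 0" and mw: "m w > 0" and m: "m differentiable at w" and k: "k differentiable at w"
    and h_def: "h = (\<lambda>w. w powr (- (real p / 2)) * inverse (m w))"
  obtains g' where "((\<lambda>w. k w / h w) has_real_derivative g') (at w)"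
    and "risk_diff p m k w = w * h w * (4 * g' + (k w / h w)\<^sup>2 * h w)"
proof
  have dm: "(m has_real_derivative deriv m w) (at w)"
    and dk: "(k has_real_derivative deriv k w) (at w)"
    using m k by (simp_all add: DERIV_deriv_iff_real_differentiable)
  let ?g' = "w powr (real p / 2) * (m w * deriv k w + deriv m w * k w + real p / 2 / w * m w * k w)"
  \<comment> \<open>With \<open>inverse 0 = 0\<close> this holds for every real \<open>v\<close>, so
    the two functions are equal outright and not only near \<open>w\<close>.\<close>
  have "k v / h v = k v * m v * v powr (real p / 2)" for v
    by (simp add: h_def powr_minus field_simps)
  then have eq: "(\<lambda>v. k v / h v) = (\<lambda>v. k v * m v * v powr (real p / 2))" by (rule ext)
  have "((\<lambda>v. v powr (real p / 2)) has_real_derivative w powr (real p / 2) * (real p / 2 / w)) (at w)"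
    using w by (auto intro!: derivative_eq_intros simp: powr_diff)
  then show "((\<lambda>w. k w / h w) has_real_derivative ?g') (at w)"
    unfolding eq by (rule DERIV_cong[OF DERIV_mult[OF DERIV_mult[OF dk dm]]]) (simp add: algebra_simps)
  have "w powr (real p / 2) > 0" using w by simp
  then show "risk_diff p m k w = w * h w * (4 * ?g' + (k w / h w)\<^sup>2 * h w)"
    using w mw by (simp add: risk_diff_def h_def powr_minus field_simps power2_eq_square)
qed

theorem theorem2p1:
  fixes m :: "real \<Rightarrow> real"
  assumes "pos_differentiable m"
    and "(\<integral>\<^sup>+ w \<in> {0<..1}. ennreal (w powr (- (real CARD('n) / 2)) * inverse (m w)) \<partial>lborel) = \<infinity>"
    and "(\<integral>\<^sup>+ w \<in> {1..}. ennreal (w powr (- (real CARD('n) / 2)) * inverse (m w)) \<partial>lborel) = \<infinity>"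
  shows "quasi_admissible (delta m :: real ^ 'n \<Rightarrow> real ^ 'n)"
  unfolding quasi_admissible_delta_iff[OF assms(1)]
proof (rule notI, elim exE conjE)
  fix k w0
  assume k: "k differentiable_on {0<..}"
    and le: "\<forall>w>0. risk_diff CARD('n) m k w \<le> 0"
    and w0: "0 < w0" "risk_diff CARD('n) m k w0 < 0"
  define h where "h = (\<lambda>w. w powr (- (real CARD('n) / 2)) * inverse (m w))"
  have m_pos: "m w > 0" if "0 < w" for w
    using assms(1) that by (auto simp: pos_differentiable_def)
  have m_diff: "m differentiable_on {0<..}"
    using assms(1) by (simp add: pos_differentiable_def)
  have diff: "m differentiable at w" "k differentiable at w" if "0 < w" for w
    using m_diff k that by (auto simp: differentiable_on_eq_differentiable_at)
  have h_pos: "h w > 0" if "0 < w" for w using m_pos[OF that] that by (simp add: h_def)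
  have "\<exists>g'. ((\<lambda>w. k w / h w) has_real_derivative g') (at w) \<and>
      risk_diff CARD('n) m k w = w * h w * (4 * g' + (k w / h w)\<^sup>2 * h w)" if "0 < w" for w
    using risk_diff_eq[OF that m_pos[OF that] diff[OF that] h_def] by blast
  then obtain g' where g': "((\<lambda>w. k w / h w) has_real_derivative g' w) (at w)"
      and risk: "risk_diff CARD('n) m k w = w * h w * (4 * g' w + (k w / h w)\<^sup>2 * h w)"
    if "0 < w" for w by metis
  have "4 * g' w + (k w / h w)\<^sup>2 * h w \<le> 0" if "0 < w" for w
    using le risk[OF that] h_pos[OF that] that by (auto simp: mult_le_0_iff)
  moreover have "continuous_on {0<..} h"
    unfolding h_def using differentiable_imp_continuous_on[OF m_diff] m_pos
    by (intro continuous_intros) (auto simp: less_imp_neq[symmetric])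
  ultimately have "k w / h w = 0" if "0 < w" for w
    using riccati_inequality_solution_zero[of h "\<lambda>w. k w / h w" g'] that g' h_pos assms(2,3)
    by (auto simp: h_def less_imp_le)
  then have k0: "k w = 0" if "0 < w" for w using h_pos that by (metis divide_eq_0_iff less_irrefl)
  \<comment> \<open>The risk difference also involves \<open>deriv k\<close>, which vanishes at
    \<open>w0\<close> because \<open>k\<close> is zero on an open set around it.\<close>
  have "(k has_real_derivative 0) (at w0)"
    by (rule has_field_derivative_transform_within_open[OF DERIV_const[of 0], of "{0<..}"])
      (use w0 k0 in auto)
  then have "risk_diff CARD('n) m k w0 = 0"
    using k0[OF w0(1)] by (simp add: risk_diff_def DERIV_imp_deriv)
  with w0(2) show False by simp
qed

end
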